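(* Let $B$ be a $C^*$-algebra, let $X$ be a Hilbert $C^*$-module over $B$, let $M,N\subset X$ be complemented submodules, and let $P_M,P_N\in\mathrm{End}^*_B(X)$ be the orthogonal projections onto $M$ and $N$. Then the pair $(M,N)$ is concordant, i.e. $X=(M\cap N)\oplus\overline{(M^\perp+N^\perp)}$, if and only if the sequence $\big((P_NP_M)^n\big)_{n}$ is Cauchy in the $*$-strong module topology on $\mathrm{End}^*_B(X)$.
   Context: $\mathrm{End}^*_B(X)$ is the unital $C^*$-algebra of adjointable operators on $X$. For a submodule $\Omega\subset X$, $\Omega^\perp=\{x\in X:\langle x,y\rangle=0\ \forall y\in\Omega\}$; a closed submodule $\Omega$ is complemented if $X=\Omega\oplus\Omega^\perp$, equivalently if it is the range of an adjointable projection $P_\Omega=P_\Omega^*=P_\Omega^2$. The pair $(M,N)$ of complemented submodules is called concordant if $X=(M\cap N)\oplus\overline{(M^\perp+N^\perp)}$ (orthogonal direct sum; the bar is norm closure). The $*$-strong module topology on $\mathrm{End}^*_B(X)$ is the locally convex topology defined by the seminorms $\|T\|_x:=\max\{\|Tx\|,\|T^*x\|\}$, $x\in X$. *)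

theory Defs
  imports "HOL-Analysis.Analysis" "HOL-Library.Set_Algebras"
begin

class complex_banach = banach +
  fixes scaleC :: "complex \<Rightarrow> 'a \<Rightarrow> 'a" (infixr "*\<^sub>C" 75)
  assumes scaleC_add_right: "c *\<^sub>C (x + y) = c *\<^sub>C x + c *\<^sub>C y"
    and scaleC_add_left: "(c + d) *\<^sub>C x = c *\<^sub>C x + d *\<^sub>C x"
    and scaleC_scaleC: "c *\<^sub>C d *\<^sub>C x = (c * d) *\<^sub>C x"
    and scaleC_of_real: "complex_of_real r *\<^sub>C x = r *\<^sub>R x"
    and norm_scaleC: "norm (c *\<^sub>C x) = cmod c * norm x"

text \<open>C*-algebras are not assumed to be unital.\<close>

class cstar_algebra = real_normed_algebra + complex_banach +
  fixes star :: "'a \<Rightarrow> 'a"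
  assumes scaleC_mult_left: "(c *\<^sub>C a) * b = c *\<^sub>C (a * b)"
    and scaleC_mult_right: "a * (c *\<^sub>C b) = c *\<^sub>C (a * b)"
    and star_add: "star (a + b) = star a + star b"
    and star_scaleC: "star (c *\<^sub>C a) = cnj c *\<^sub>C star a"
    and star_mult: "star (a * b) = star b * star a"
    and star_star: "star (star a) = a"
    and cstar_identity: "norm (star a * a) = (norm a)\<^sup>2"

definition cstar_positive :: "'b::cstar_algebra \<Rightarrow> bool" where
  "cstar_positive a \<longleftrightarrow> (\<exists>b. a = star b * b)"

text \<open>Right Hilbert modules, with inner product linear in the second argument. The locale assumption
  \<open>norm_eq\<close> says that the norm of the type \<open>'x\<close> is the one induced by the inner product, so
  completeness of the module is the completeness contained in the class.\<close>

locale hilbert_module =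
  fixes act :: "'x::complex_banach \<Rightarrow> 'b::cstar_algebra \<Rightarrow> 'x"
    and ip :: "'x \<Rightarrow> 'x \<Rightarrow> 'b"
  assumes act_add_left: "act (x + y) a = act x a + act y a"
    and act_add_right: "act x (a + b) = act x a + act x b"
    and act_mult: "act x (a * b) = act (act x a) b"
    and act_scaleC_left: "act (c *\<^sub>C x) a = c *\<^sub>C act x a"
    and act_scaleC_right: "act x (c *\<^sub>C a) = c *\<^sub>C act x a"
    and ip_add: "ip x (y + z) = ip x y + ip x z"
    and ip_scaleC: "ip x (c *\<^sub>C y) = c *\<^sub>C ip x y"
    and ip_act: "ip x (act y a) = ip x y * a"
    and ip_star: "ip y x = star (ip x y)"
    and ip_positive: "cstar_positive (ip x x)"
    and ip_definite: "ip x x = 0 \<Longrightarrow> x = 0"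
    and norm_eq: "norm x = sqrt (norm (ip x x))"

definition submodule :: "('x::complex_banach \<Rightarrow> 'b::cstar_algebra \<Rightarrow> 'x) \<Rightarrow> 'x set \<Rightarrow> bool" where
  "submodule act \<Omega> \<longleftrightarrow> 0 \<in> \<Omega> \<and> (\<forall>x\<in>\<Omega>. \<forall>y\<in>\<Omega>. x + y \<in> \<Omega>) \<and>
     (\<forall>c. \<forall>x\<in>\<Omega>. c *\<^sub>C x \<in> \<Omega>) \<and> (\<forall>b. \<forall>x\<in>\<Omega>. act x b \<in> \<Omega>)"

definition orth_compl :: "('x \<Rightarrow> 'x \<Rightarrow> 'b::cstar_algebra) \<Rightarrow> 'x set \<Rightarrow> 'x set" where
  "orth_compl ip \<Omega> = {x. \<forall>y\<in>\<Omega>. ip x y = 0}"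

text \<open>The whole module is the orthogonal direct sum of \<open>U\<close> and \<open>V\<close>; orthogonality makes the
  decomposition unique.\<close>

definition orth_direct_sum ::
    "('x::complex_banach \<Rightarrow> 'x \<Rightarrow> 'b::cstar_algebra) \<Rightarrow> 'x set \<Rightarrow> 'x set \<Rightarrow> bool" where
  "orth_direct_sum ip U V \<longleftrightarrow> (\<forall>u\<in>U. \<forall>v\<in>V. ip u v = 0) \<and> U + V = UNIV"

definition complemented ::
    "('x::complex_banach \<Rightarrow> 'b::cstar_algebra \<Rightarrow> 'x) \<Rightarrow> ('x \<Rightarrow> 'x \<Rightarrow> 'b) \<Rightarrow> 'x set \<Rightarrow> bool" where
  "complemented act ip \<Omega> \<longleftrightarrow>
     submodule act \<Omega> \<and> closed \<Omega> \<and> orth_direct_sum ip \<Omega> (orth_compl ip \<Omega>)"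

definition concordant ::
    "('x::complex_banach \<Rightarrow> 'x \<Rightarrow> 'b::cstar_algebra) \<Rightarrow> 'x set \<Rightarrow> 'x set \<Rightarrow> bool" where
  "concordant ip M N \<longleftrightarrow>
     orth_direct_sum ip (M \<inter> N) (closure (orth_compl ip M + orth_compl ip N))"

definition is_adj :: "('x \<Rightarrow> 'x \<Rightarrow> 'b::cstar_algebra) \<Rightarrow> ('x \<Rightarrow> 'x) \<Rightarrow> ('x \<Rightarrow> 'x) \<Rightarrow> bool" where
  "is_adj ip T S \<longleftrightarrow> (\<forall>x y. ip (T x) y = ip x (S y))"

text \<open>Linearity and boundedness are automatic for adjointable maps, and the adjoint is unique.\<close>

definition End_adj :: "('x \<Rightarrow> 'x \<Rightarrow> 'b::cstar_algebra) \<Rightarrow> ('x \<Rightarrow> 'x) set" where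
  "End_adj ip = {T. \<exists>S. is_adj ip T S}"

definition adj :: "('x \<Rightarrow> 'x \<Rightarrow> 'b::cstar_algebra) \<Rightarrow> ('x \<Rightarrow> 'x) \<Rightarrow> 'x \<Rightarrow> 'x" where
  "adj ip T = (THE S. is_adj ip T S)"

definition is_orth_proj :: "('x \<Rightarrow> 'x \<Rightarrow> 'b::cstar_algebra) \<Rightarrow> 'x set \<Rightarrow> ('x \<Rightarrow> 'x) \<Rightarrow> bool" where
  "is_orth_proj ip \<Omega> P \<longleftrightarrow> P \<in> End_adj ip \<and> adj ip P = P \<and> P \<circ> P = P \<and> range P = \<Omega>"

definition star_strong_seminorm ::
    "('x::complex_banach \<Rightarrow> 'x \<Rightarrow> 'b::cstar_algebra) \<Rightarrow> 'x \<Rightarrow> ('x \<Rightarrow> 'x) \<Rightarrow> real" where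
  "star_strong_seminorm ip x T = max (norm (T x)) (norm (adj ip T x))"

definition star_strong_topology ::
    "('x::complex_banach \<Rightarrow> 'x \<Rightarrow> 'b::cstar_algebra) \<Rightarrow> ('x \<Rightarrow> 'x) topology" where
  "star_strong_topology ip = topology_generated_by
     {{T \<in> End_adj ip. star_strong_seminorm ip x (T - S) < e} | S x e. S \<in> End_adj ip \<and> e > 0}"

text \<open>Cauchy sequences for the uniformity of the additive topological group \<open>End_adj ip\<close>.\<close>

definition star_strong_Cauchy ::
    "('x::complex_banach \<Rightarrow> 'x \<Rightarrow> 'b::cstar_algebra) \<Rightarrow> (nat \<Rightarrow> 'x \<Rightarrow> 'x) \<Rightarrow> bool" where
  "star_strong_Cauchy ip T \<longleftrightarrow> (\<forall>n. T n \<in> End_adj ip) \<and>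
     (\<forall>U. openin (star_strong_topology ip) U \<and> (\<lambda>_. 0) \<in> U \<longrightarrow>
        (\<exists>k. \<forall>m\<ge>k. \<forall>n\<ge>k. T m - T n \<in> U))"

end

theory Submission
  imports Defs
begin

text \<open>
  Write \<open>P, Q\<close> for the projections onto \<open>M, N\<close> and \<open>T = Q P\<close>. If \<open>T\<^sup>n x\<close> converges to \<open>y\<close>, then
  \<open>T y = y\<close> forces \<open>y \<in> M \<inter> N\<close>, while \<open>x - T\<^sup>n x\<close> telescopes into \<open>M\<^sup>\<bottom> + N\<^sup>\<bottom>\<close>; this gives
  concordance.

  For the converse, \<open>T\<^sup>n\<close> is the identity on \<open>M \<inter> N\<close>, \<open>T\<close> vanishes on \<open>M\<^sup>\<bottom>\<close>, and it remains to see
  that \<open>T\<^sup>n x \<rightarrow> 0\<close> for \<open>x \<in> N\<^sup>\<bottom>\<close>. Reflections are isometric, so on \<open>N\<close> the map \<open>T\<close> is the average of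
  the identity and the contraction \<open>Q (2 P - 1)\<close>, which yields the uniform estimate
  \<open>\<parallel>T\<^sup>n y - T\<^sup>n\<^sup>+\<^sup>1 y\<parallel> \<le> \<parallel>y\<parallel> / \<surd>(n + 1)\<close>. The same estimate for \<open>T\<^sup>* = P Q\<close> on \<open>M\<close> shows that
  \<open>(1 - Q) (T\<^sup>*)\<^sup>n\<close> tends to \<open>0\<close> in norm, hence so does its adjoint \<open>T\<^sup>n (1 - Q)\<close>.
\<close>

section \<open>Mean absolute deviation of the symmetric binomial distribution\<close>

text \<open>Up to the factor \<open>2 ^ n\<close> this is the variance \<open>n\<close> of a sum of
  \<open>n\<close> independent fair signs, read off from the moments of the Bernstein weights at
  \<open>1/2\<close>.\<close>

lemma sum_binomial_second_moment:
  "(\<Sum>k\<le>n. real (n choose k) * (real n - 2 * real k)\<^sup>2) = real n * 2 ^ n"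
proof -
  let ?B = "\<lambda>k. Bernstein n k (1/2)"
  have B: "real (n choose k) = 2 ^ n * ?B k" if "k \<le> n" for k
    using that by (simp add: Bernstein_def power_one_over field_simps flip: power_add)
  \<comment> \<open>The square equals \<open>n^2 + 4 k (k - 1) + (4 - 4 n) k\<close>, a combination
    whose Bernstein sums are known.\<close>
  have "(\<Sum>k\<le>n. real (n choose k) * (real n - 2 * real k)\<^sup>2)
      = 2 ^ n * (\<Sum>k\<le>n. (real n)\<^sup>2 * ?B k + 4 * (real k * (real k - 1) * ?B k)
          + (4 - 4 * real n) * (real k * ?B k))"
    unfolding sum_distrib_left
    by (intro sum.cong refl) (simp add: B, simp add: power2_eq_square algebra_simps)
  also have "\<dots> = 2 ^ n * ((real n)\<^sup>2 + 4 * (real n * (real n - 1) * (1/2)\<^sup>2)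
      + (4 - 4 * real n) * (real n * (1/2)))"
    unfolding sum.distrib
    by (simp flip: sum_distrib_left add: sum_k_Bernstein sum_kk_Bernstein)
  also have "\<dots> = real n * 2 ^ n"
    by (simp add: power2_eq_square algebra_simps)
  finally show ?thesis .
qed

text \<open>Mean deviation is at most standard deviation. AM-GM with weight \<open>sqrt n\<close>
  takes the place of Cauchy-Schwarz: both terms on its right then sum to
  \<open>n * 2 ^ n\<close>.\<close>

lemma sum_binomial_abs_deviation:
  "(\<Sum>k\<le>n. real (n choose k) * \<bar>real n - 2 * real k\<bar>) \<le> sqrt (real n) * 2 ^ n"
proof (cases "n = 0")
  case False
  let ?d = "\<lambda>k. real n - 2 * real k"
  have amgm: "2 * sqrt (real n) * \<bar>?d k\<bar> \<le> real n + (?d k)\<^sup>2" for k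
    using sum_squares_bound[of "sqrt (real n)" "\<bar>?d k\<bar>"] by simp
  have total: "(\<Sum>k\<le>n. real (n choose k)) = 2 ^ n"
    using choose_row_sum[of n] by (metis of_nat_numeral of_nat_power of_nat_sum)
  have "2 * sqrt (real n) * (\<Sum>k\<le>n. real (n choose k) * \<bar>?d k\<bar>)
      = (\<Sum>k\<le>n. real (n choose k) * (2 * sqrt (real n) * \<bar>?d k\<bar>))"
    by (simp add: sum_distrib_left algebra_simps)
  also have "\<dots> \<le> (\<Sum>k\<le>n. real (n choose k) * (real n + (?d k)\<^sup>2))"
    by (intro sum_mono mult_left_mono amgm) auto
  also have "\<dots> = 2 * sqrt (real n) * (sqrt (real n) * 2 ^ n)"
    by (simp add: distrib_left sum.distrib sum_binomial_second_moment total
        flip: sum_distrib_right)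
  finally show ?thesis
    using False by simp
qed simp

section \<open>Powers of averaged contractions\<close>

lemma funpow_averaged_binomial:
  fixes V :: "'a::real_vector \<Rightarrow> 'a"
  assumes "linear V"
  defines "W \<equiv> \<lambda>x. (1/2) *\<^sub>R (x + V x)"
  shows "2 ^ n *\<^sub>R (W ^^ n) x = (\<Sum>k\<le>n. real (n choose k) *\<^sub>R (V ^^ k) x)"
proof (induction n)
  case (Suc n)
  interpret linear V by fact
  have "2 ^ Suc n *\<^sub>R (W ^^ Suc n) x = 2 ^ n *\<^sub>R (W ^^ n) x + V (2 ^ n *\<^sub>R (W ^^ n) x)"
    by (simp add: W_def scaleR scaleR_add_right)
  \<comment> \<open>The first sum may run to \<open>Suc n\<close> because
    \<open>n choose Suc n\<close> is 0; after the index shift Pascal's rule applies.\<close>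
  also have "\<dots> = (\<Sum>k\<le>Suc n. real (n choose k) *\<^sub>R (V ^^ k) x)
      + (\<Sum>k\<le>n. real (n choose k) *\<^sub>R (V ^^ Suc k) x)"
    unfolding Suc.IH by (simp add: sum scaleR)
  also have "\<dots> = (\<Sum>k\<le>Suc n. real (Suc n choose k) *\<^sub>R (V ^^ k) x)"
    unfolding sum.atMost_Suc_shift
    by (simp add: sum.distrib scaleR_add_left add_ac)
  finally show ?case .
qed simp

lemma norm_funpow_le:
  fixes V :: "'a::real_normed_vector \<Rightarrow> 'a"
  assumes "\<And>x. norm (V x) \<le> norm x"
  shows "norm ((V ^^ n) x) \<le> norm x"
  by (induction n) (auto intro: order_trans[OF assms])

lemma linear_funpow:
  fixes V :: "'a::real_vector \<Rightarrow> 'a"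
  assumes "linear V"
  shows "linear (V ^^ n)"
proof (induction n)
  case (Suc n)
  then show ?case
    unfolding funpow.simps by (rule linear_compose) fact
qed (simp add: id_def linear_ident)

text \<open>The coefficients of \<open>(1 + V)\<^sup>n (1 - V)\<close> are
  \<open>(N choose k) (N - 2 k) / N\<close> with \<open>N = n + 1\<close>, so their absolute sum is controlled by
  the mean absolute deviation of the binomial distribution.\<close>

lemma averaged_contraction_asymptotically_regular:
  fixes V :: "'a::real_normed_vector \<Rightarrow> 'a"
  assumes V: "linear V" "\<And>x. norm (V x) \<le> norm x"
  defines "W \<equiv> \<lambda>x. (1/2) *\<^sub>R (x + V x)"
  shows "norm ((W ^^ n) x - (W ^^ Suc n) x) \<le> norm x / sqrt (real (Suc n))"
proof -
  interpret V: linear V by fact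
  have "linear W"
    unfolding W_def
    by (intro linear_compose_scale_right linear_compose_add V linear_ident)
  then interpret Wn: linear "W ^^ n" by (rule linear_funpow)
  define N where "N = Suc n"
  let ?a = "\<lambda>k. real (N choose k) *\<^sub>R (V ^^ k) x"
  \<comment> \<open>The weight \<open>N - 2 k\<close> is split as \<open>(N - k) - k\<close>. By
    absorption the two halves reassemble \<open>(W ^^ n) x\<close> and
    \<open>(W ^^ n) (V x)\<close>, whose difference is twice the step to be bounded.\<close>
  have 1: "(\<Sum>k\<le>N. (real N - real k) *\<^sub>R ?a k) = real N *\<^sub>R (2 ^ n *\<^sub>R (W ^^ n) x)"
  proof -
    have "(\<Sum>k\<le>N. (real N - real k) *\<^sub>R ?a k) = (\<Sum>k\<le>n. (real N - real k) *\<^sub>R ?a k)"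
      by (simp add: N_def)
    also have "\<dots> = (\<Sum>k\<le>n. (real N * real (n choose k)) *\<^sub>R (V ^^ k) x)"
    proof (intro sum.cong refl)
      fix k assume "k \<in> {..n}"
      then have "(N - k) * (N choose k) = N * (n choose k)"
        by (metis N_def atMost_iff binomial_absorb_comp diff_Suc_1)
      then have "(real N - real k) * real (N choose k) = real N * real (n choose k)"
        using \<open>k \<in> {..n}\<close>
        by (metis N_def atMost_iff le_Suc_eq of_nat_diff of_nat_mult)
      then show "(real N - real k) *\<^sub>R ?a k = (real N * real (n choose k)) *\<^sub>R (V ^^ k) x"
        by simp
    qed
    finally show ?thesis
      unfolding W_def funpow_averaged_binomial[OF V(1)] by (simp add: scaleR_sum_right)
  qed
  have 2: "(\<Sum>k\<le>N. real k *\<^sub>R ?a k) = real N *\<^sub>R (2 ^ n *\<^sub>R (W ^^ n) (V x))"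
  proof -
    have "(\<Sum>k\<le>N. real k *\<^sub>R ?a k) = (\<Sum>k\<le>n. (real (Suc k) * real (N choose Suc k)) *\<^sub>R (V ^^ Suc k) x)"
      unfolding N_def sum.atMost_Suc_shift by simp
    also have "\<dots> = (\<Sum>k\<le>n. (real N * real (n choose k)) *\<^sub>R (V ^^ k) (V x))"
      unfolding N_def of_nat_mult[symmetric] Suc_times_binomial funpow_Suc_right by simp
    finally show ?thesis
      unfolding W_def funpow_averaged_binomial[OF V(1)] by (simp add: scaleR_sum_right)
  qed
  have "(W ^^ n) x - (W ^^ Suc n) x = (W ^^ n) ((1/2) *\<^sub>R (x - V x))"
  proof -
    have "x - W x = (1/2) *\<^sub>R (x - V x)"
    proof -
      have "2 *\<^sub>R (x - W x) = x - V x"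
        by (simp add: W_def scaleR_diff_right) (simp add: scaleR_2)
      then have "(1/2) *\<^sub>R (2 *\<^sub>R (x - W x)) = (1/2) *\<^sub>R (x - V x)"
        by (rule arg_cong)
      then show ?thesis by simp
    qed
    then show ?thesis
      by (simp add: funpow_Suc_right flip: Wn.diff del: funpow.simps)
  qed
  also have "\<dots> = (1/2) *\<^sub>R ((W ^^ n) x - (W ^^ n) (V x))"
    by (simp add: Wn.scaleR Wn.diff)
  finally have "(real N * 2 ^ N) *\<^sub>R ((W ^^ n) x - (W ^^ Suc n) x)
      = (\<Sum>k\<le>N. (real N - real k) *\<^sub>R ?a k) - (\<Sum>k\<le>N. real k *\<^sub>R ?a k)"
    unfolding 1 2 by (simp add: N_def scaleR_diff_right)
  also have "\<dots> = (\<Sum>k\<le>N. (real N - 2 * real k) *\<^sub>R ?a k)"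
    unfolding sum_subtractf[symmetric] by (simp add: algebra_simps flip: scaleR_diff_left)
  finally have eq: "(real N * 2 ^ N) *\<^sub>R ((W ^^ n) x - (W ^^ Suc n) x)
      = (\<Sum>k\<le>N. (real N - 2 * real k) *\<^sub>R ?a k)" .
  have "real N * 2 ^ N * norm ((W ^^ n) x - (W ^^ Suc n) x)
      = norm (\<Sum>k\<le>N. (real N - 2 * real k) *\<^sub>R ?a k)"
    unfolding eq[symmetric] by simp
  also have "\<dots> \<le> (\<Sum>k\<le>N. real (N choose k) * \<bar>real N - 2 * real k\<bar> * norm x)"
    by (intro sum_norm_le)
      (simp add: abs_mult mult.assoc[symmetric] mult.commute[of "\<bar>_\<bar>"] mult_left_mono norm_funpow_le V(2))
  also have "\<dots> \<le> sqrt (real N) * 2 ^ N * norm x"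
    unfolding sum_distrib_right[symmetric]
    by (intro mult_right_mono sum_binomial_abs_deviation) auto
  finally have le: "real N * 2 ^ N * norm ((W ^^ n) x - (W ^^ Suc n) x) \<le> sqrt (real N) * 2 ^ N * norm x" .
  have "(sqrt (real N) * 2 ^ N) * (sqrt (real N) * norm ((W ^^ n) x - (W ^^ Suc n) x))
      = (sqrt (real N) * sqrt (real N)) * 2 ^ N * norm ((W ^^ n) x - (W ^^ Suc n) x)"
    by (simp only: mult_ac)
  also have "\<dots> \<le> (sqrt (real N) * 2 ^ N) * norm x"
    using le by (simp del: funpow.simps)
  finally have "(sqrt (real N) * 2 ^ N) * (sqrt (real N) * norm ((W ^^ n) x - (W ^^ Suc n) x))
      \<le> (sqrt (real N) * 2 ^ N) * norm x" .
  then have "sqrt (real N) * norm ((W ^^ n) x - (W ^^ Suc n) x) \<le> norm x"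
    by (rule mult_left_le_imp_le) (simp add: N_def)
  then show ?thesis
    by (simp add: N_def pos_le_divide_eq mult.commute del: funpow.simps of_nat_Suc)
qed

section \<open>Inner product estimates\<close>

context hilbert_module
begin

lemma ip_add_left: "ip (x + y) z = ip x z + ip y z"
  by (metis ip_add ip_star star_add)

lemma ip_scaleC_left: "ip (c *\<^sub>C x) y = cnj c *\<^sub>C ip x y"
  by (metis ip_scaleC ip_star star_scaleC)

lemma linear_ip_right: "linear (ip x)"
  by (rule linearI) (metis ip_add, metis ip_scaleC scaleC_of_real)

lemma linear_ip_left: "linear (\<lambda>x. ip x y)"
  by (rule linearI)
    (metis ip_add_left, metis ip_scaleC_left scaleC_of_real complex_cnj_complex_of_real)

lemmas ip_diff_right = linear_diff[OF linear_ip_right]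
  and ip_diff_left = linear_diff[OF linear_ip_left]
  and ip_scaleR_right = linear_scale[OF linear_ip_right]
  and ip_scaleR_left = linear_scale[OF linear_ip_left]
  and ip_zero_right = linear_0[OF linear_ip_right]
  and ip_zero_left = linear_0[OF linear_ip_left]

lemma norm_power2_eq: "(norm x)\<^sup>2 = norm (ip x x)"
  by (simp add: norm_eq)

text \<open>The factor \<open>- \<i>\<close> turns the second difference into
  \<open>2 (ip x y - ip y x)\<close>, which cancels \<open>ip y x\<close>. Only values
  \<open>q z\<close> remain, and their norms are the squares \<open>(norm z)^2\<close>.\<close>

lemma ip_polarization:
  defines "q \<equiv> \<lambda>x. ip x x"
  shows "4 *\<^sub>R ip x y = (q (x + y) - q (x - y)) - \<i> *\<^sub>C (q (x + \<i> *\<^sub>C y) - q (x - \<i> *\<^sub>C y))"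
proof -
  have q: "q (x + z) - q (x - z) = 2 *\<^sub>R (ip x z + ip z x)" for z
    by (simp add: q_def ip_add ip_add_left ip_diff_left ip_diff_right scaleR_2)
  have i: "\<i> *\<^sub>C 2 *\<^sub>R (ip x (\<i> *\<^sub>C y) + ip (\<i> *\<^sub>C y) x) = 2 *\<^sub>R (ip y x - ip x y)"
  proof -
    have "\<i> *\<^sub>C 2 *\<^sub>R (ip x (\<i> *\<^sub>C y) + ip (\<i> *\<^sub>C y) x)
        = complex_of_real (-2) *\<^sub>C ip x y + complex_of_real 2 *\<^sub>C ip y x"
      by (simp add: ip_scaleC ip_scaleC_left scaleC_add_right scaleC_scaleC mult.left_commute[of \<i> 2] flip: scaleC_of_real)
    then show ?thesis
      by (simp only: scaleC_of_real) (simp add: scaleR_diff_right)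
  qed
  show ?thesis
    unfolding q i by (simp add: scaleR_diff_right scaleR_add_right flip: scaleR_add_left)
qed

text \<open>The constant 4 is not optimal. It comes from polarization and the triangle inequality alone
  and spares us the positive cone of the C*-algebra.\<close>

lemma norm_ip_le: "norm (ip x y) \<le> 4 * norm x * norm y"
proof -
  have *: "norm (ip x y) \<le> (norm x + norm y)\<^sup>2" for x y
  proof -
    have q: "norm (ip (x + z) (x + z) - ip (x - z) (x - z)) \<le> 2 * (norm x + norm y)\<^sup>2"
      if "norm z = norm y" for z
    proof -
      have "norm (ip (x + z) (x + z) - ip (x - z) (x - z)) \<le> (norm (x + z))\<^sup>2 + (norm (x - z))\<^sup>2"
        unfolding norm_power2_eq by (rule norm_triangle_ineq4)
      also have "\<dots> \<le> (norm x + norm z)\<^sup>2 + (norm x + norm z)\<^sup>2"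
        by (intro add_mono power_mono norm_triangle_ineq norm_triangle_ineq4) auto
      finally show ?thesis using that by simp
    qed
    have "4 * norm (ip x y) = norm (4 *\<^sub>R ip x y)" by simp
    also have "\<dots> \<le> norm (ip (x + y) (x + y) - ip (x - y) (x - y))
        + norm (ip (x + \<i> *\<^sub>C y) (x + \<i> *\<^sub>C y) - ip (x - \<i> *\<^sub>C y) (x - \<i> *\<^sub>C y))"
      unfolding ip_polarization
      by (rule order_trans[OF norm_triangle_ineq4]) (simp add: norm_scaleC)
    also have "\<dots> \<le> 2 * (norm x + norm y)\<^sup>2 + 2 * (norm x + norm y)\<^sup>2"
      by (intro add_mono q) (simp_all add: norm_scaleC)
    finally show ?thesis by simp
  qed
  show ?thesis
  proof (cases "x = 0 \<or> y = 0")
    case True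
    then show ?thesis by (auto simp: ip_zero_left ip_zero_right)
  next
    case False
    \<comment> \<open>For unit vectors the bound is \<open>(1 + 1)^2 = 4\<close>; homogeneity
      restores the product of the norms.\<close>
    have "norm (ip (x /\<^sub>R norm x) (y /\<^sub>R norm y)) \<le> 4"
      using *[of "x /\<^sub>R norm x" "y /\<^sub>R norm y"] False by simp
    then show ?thesis
      using False by (simp add: ip_scaleR_left ip_scaleR_right field_simps)
  qed
qed

lemma bounded_linear_ip_right: "bounded_linear (ip x)"
  using linear_ip_right norm_ip_le[of x]
  by (intro bounded_linear_intro[where K = "4 * norm x"])
    (auto simp: linear_add linear_scale mult_ac)

lemma ip_right_eqI:
  assumes "\<And>z. ip z x = ip z y"
  shows "x = y"
  using ip_definite[of "x - y"] assms by (simp add: ip_diff_right)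

section \<open>Adjoints\<close>

lemma is_adj_sym: "is_adj ip T S \<Longrightarrow> is_adj ip S T"
  unfolding is_adj_def by (metis ip_star)

text \<open>Nondegeneracy of \<open>ip\<close> makes adjoints unique, so the \<open>THE\<close> in
  \<open>adj\<close> can be evaluated once an adjoint is exhibited, and the relation
  \<open>is_adj\<close> can be used instead.\<close>

lemma adj_eq:
  assumes "is_adj ip T S"
  shows "adj ip T = S"
  unfolding adj_def
proof (rule the_equality)
  fix S' assume "is_adj ip T S'"
  with assms show "S' = S"
    unfolding is_adj_def by (metis ip_right_eqI ext)
qed fact

lemma is_adj_linear:
  assumes "is_adj ip T S"
  shows "linear T"
  using is_adj_sym[OF assms] unfolding is_adj_def
  by (intro linearI ip_right_eqI)
    (metis linear_add[OF linear_ip_right], metis linear_scale[OF linear_ip_right])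

lemma is_adj_diff:
  "is_adj ip T S \<Longrightarrow> is_adj ip T' S' \<Longrightarrow> is_adj ip (T - T') (S - S')"
  unfolding is_adj_def by (simp add: ip_diff_left ip_diff_right)

lemma is_adj_zero: "is_adj ip (\<lambda>_. 0) (\<lambda>_. 0)"
  unfolding is_adj_def by (simp add: ip_zero_left ip_zero_right)

lemma is_adj_comp: "is_adj ip T S \<Longrightarrow> is_adj ip T' S' \<Longrightarrow> is_adj ip (T \<circ> T') (S' \<circ> S)"
  unfolding is_adj_def by simp

lemma is_adj_funpow: "is_adj ip T S \<Longrightarrow> is_adj ip (T ^^ n) (S ^^ n)"
proof (induction n)
  case (Suc n)
  have "is_adj ip (T ^^ Suc n) (S ^^ n \<circ> S)"
    using is_adj_comp[OF Suc.prems Suc.IH[OF Suc.prems]] by simp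
  then show ?case
    unfolding funpow_Suc_right[of n S] .
qed (simp add: is_adj_def)

section \<open>Cauchy sequences in the star-strong topology\<close>

lemma star_strong_seminorm_eq:
  "is_adj ip T S \<Longrightarrow> star_strong_seminorm ip x T = max (norm (T x)) (norm (S x))"
  by (simp add: star_strong_seminorm_def adj_eq)

text \<open>Subbasic balls have arbitrary centres \<open>S\<close>; this triangle inequality fits a
  ball about 0 into any of them that contains 0.\<close>

lemma star_strong_seminorm_diff_le:
  assumes "T \<in> End_adj ip" "S \<in> End_adj ip"
  shows "star_strong_seminorm ip x (T - S)
    \<le> star_strong_seminorm ip x T + star_strong_seminorm ip x ((\<lambda>_. 0) - S)"
proof -
  from assms obtain T' S' where *: "is_adj ip T T'" "is_adj ip S S'"
    by (auto simp: End_adj_def)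
  show ?thesis
    unfolding star_strong_seminorm_eq[OF is_adj_diff[OF *]] star_strong_seminorm_eq[OF *(1)]
      star_strong_seminorm_eq[OF is_adj_diff[OF is_adj_zero *(2)]]
    using norm_triangle_ineq4[of "T x" "S x"] norm_triangle_ineq4[of "T' x" "S' x"]
    by (auto simp: max_def)
qed

lemma End_adj_diff: "T \<in> End_adj ip \<Longrightarrow> S \<in> End_adj ip \<Longrightarrow> T - S \<in> End_adj ip"
  unfolding End_adj_def using is_adj_diff by blast

text \<open>Balls about 0 give one direction. The other is an induction on the generation of open
  sets containing 0: an intersection takes the larger index, a union any member containing
  0.\<close>

lemma star_strong_Cauchy_iff_seminorm:
  assumes T: "\<And>n. T n \<in> End_adj ip"
  shows "star_strong_Cauchy ip T \<longleftrightarrow>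
    (\<forall>x. \<forall>e>0. \<exists>k. \<forall>m\<ge>k. \<forall>n\<ge>k. star_strong_seminorm ip x (T m - T n) < e)"
    (is "_ \<longleftrightarrow> ?R")
proof
  assume C: "star_strong_Cauchy ip T"
  show ?R
  proof (intro allI impI)
    fix x and e :: real assume "e > 0"
    let ?U = "{T \<in> End_adj ip. star_strong_seminorm ip x (T - (\<lambda>_. 0)) < e}"
    have 0: "(\<lambda>_. 0) \<in> End_adj ip"
      using is_adj_zero by (auto simp: End_adj_def)
    have "openin (star_strong_topology ip) ?U"
      unfolding star_strong_topology_def openin_topology_generated_by_iff
      by (rule generate_topology_on.Basis) (use 0 \<open>e > 0\<close> in blast)
    moreover have "(\<lambda>_. 0) \<in> ?U"
      using 0 \<open>e > 0\<close> star_strong_seminorm_eq[OF is_adj_diff[OF is_adj_zero is_adj_zero]] by simp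
    ultimately obtain k where "\<forall>m\<ge>k. \<forall>n\<ge>k. T m - T n \<in> ?U"
      using C unfolding star_strong_Cauchy_def by blast
    moreover have "T m - T n - (\<lambda>_. 0) = T m - T n" for m n
      by (simp add: fun_eq_iff)
    ultimately show "\<exists>k. \<forall>m\<ge>k. \<forall>n\<ge>k. star_strong_seminorm ip x (T m - T n) < e"
      by auto
  qed
next
  assume R: ?R
  have "\<exists>k. \<forall>m\<ge>k. \<forall>n\<ge>k. T m - T n \<in> U"
    if "openin (star_strong_topology ip) U" "(\<lambda>_. 0) \<in> U" for U
    using that unfolding star_strong_topology_def openin_topology_generated_by_iff
  proof (induction rule: generate_topology_on.induct)
    case (Int U V)
    then obtain k l where "\<forall>m\<ge>k. \<forall>n\<ge>k. T m - T n \<in> U" "\<forall>m\<ge>l. \<forall>n\<ge>l. T m - T n \<in> V"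
      by blast
    then have "\<forall>m\<ge>max k l. \<forall>n\<ge>max k l. T m - T n \<in> U \<inter> V"
      by simp
    then show ?case by blast
  next
    case (UN K)
    then show ?case by blast
  next
    case (Basis U)
    then obtain S x e where U: "U = {T \<in> End_adj ip. star_strong_seminorm ip x (T - S) < e}"
      and S: "S \<in> End_adj ip"
      by blast
    \<comment> \<open>The slack left by the off-centre position of 0, positive since 0 lies in the
      ball.\<close>
    define d where "d = e - star_strong_seminorm ip x ((\<lambda>_. 0) - S)"
    have "d > 0"
      using Basis.prems by (simp add: U d_def)
    with R obtain k where k: "\<forall>m\<ge>k. \<forall>n\<ge>k. star_strong_seminorm ip x (T m - T n) < d"
      by blast
    have "T m - T n \<in> U" if "m \<ge> k" "n \<ge> k" for m n
      using star_strong_seminorm_diff_le[OF End_adj_diff[OF T T] S, of x m n] k that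
      by (force simp: U d_def End_adj_diff T)
    then show ?case by blast
  qed simp
  then show "star_strong_Cauchy ip T"
    unfolding star_strong_Cauchy_def using T by blast
qed

text \<open>The seminorm is a maximum, so the condition splits into pointwise Cauchyness of the
  operators and of their adjoints.\<close>

lemma star_strong_Cauchy_iff:
  assumes "\<And>n. is_adj ip (T n) (S n)"
  shows "star_strong_Cauchy ip T \<longleftrightarrow> (\<forall>x. Cauchy (\<lambda>n. T n x) \<and> Cauchy (\<lambda>n. S n x))"
proof -
  have E: "T n \<in> End_adj ip" for n
    using assms by (auto simp: End_adj_def)
  have n: "star_strong_seminorm ip x (T m - T n) = max (norm (T m x - T n x)) (norm (S m x - S n x))"
    for x m n
    using star_strong_seminorm_eq[OF is_adj_diff[OF assms assms]] by simp
  have "(\<forall>e>0. \<exists>k. \<forall>m\<ge>k. \<forall>n\<ge>k. max (norm (T m x - T n x)) (norm (S m x - S n x)) < e)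
      \<longleftrightarrow> Cauchy (\<lambda>n. T n x) \<and> Cauchy (\<lambda>n. S n x)" (is "?L \<longleftrightarrow> ?R") for x
  proof
    assume ?L
    then show ?R
      unfolding Cauchy_iff by (meson max_less_iff_conj)
  next
    assume R: ?R
    show ?L
    proof (intro allI impI)
      fix e :: real assume "e > 0"
      with R obtain k l where "\<forall>m\<ge>k. \<forall>n\<ge>k. norm (T m x - T n x) < e"
        "\<forall>m\<ge>l. \<forall>n\<ge>l. norm (S m x - S n x) < e"
        unfolding Cauchy_iff by meson
      then have "\<forall>m\<ge>max k l. \<forall>n\<ge>max k l. max (norm (T m x - T n x)) (norm (S m x - S n x)) < e"
        by simp
      then show "\<exists>k. \<forall>m\<ge>k. \<forall>n\<ge>k. max (norm (T m x - T n x)) (norm (S m x - S n x)) < e" ..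
    qed
  qed
  then show ?thesis
    unfolding star_strong_Cauchy_iff_seminorm[of T, OF E] n by simp
qed

section \<open>Orthogonal projections\<close>

lemma is_orth_proj_is_adj:
  assumes "is_orth_proj ip M P"
  shows "is_adj ip P P"
proof -
  from assms obtain S where S: "is_adj ip P S" and P: "adj ip P = P"
    unfolding is_orth_proj_def End_adj_def by blast
  have "S = P"
    using adj_eq[OF S] P by (rule trans[OF sym])
  with S show ?thesis by (rule subst[rotated])
qed

lemma is_orth_proj_linear: "is_orth_proj ip M P \<Longrightarrow> linear P"
  by (rule is_adj_linear[OF is_orth_proj_is_adj])

lemma is_orth_proj_idem: "is_orth_proj ip M P \<Longrightarrow> P (P x) = P x"
  by (simp add: is_orth_proj_def fun_eq_iff)

lemma is_orth_proj_fixed_iff: "is_orth_proj ip M P \<Longrightarrow> P x = x \<longleftrightarrow> x \<in> M"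
  by (metis is_orth_proj_def is_orth_proj_idem rangeE rangeI)

lemma is_orth_proj_in: "is_orth_proj ip M P \<Longrightarrow> P x \<in> M"
  by (auto simp: is_orth_proj_def)

lemma is_orth_proj_zero_iff:
  assumes P: "is_orth_proj ip M P"
  shows "P x = 0 \<longleftrightarrow> x \<in> orth_compl ip M"
proof
  assume "P x = 0"
  have "ip x y = 0" if "y \<in> M" for y
  proof -
    have "ip x y = ip x (P y)"
      using is_orth_proj_fixed_iff[OF P, of y] that by simp
    also have "\<dots> = ip (P x) y"
      using is_orth_proj_is_adj[OF P] by (simp add: is_adj_def)
    finally show ?thesis
      using \<open>P x = 0\<close> by (simp add: ip_zero_left)
  qed
  then show "x \<in> orth_compl ip M"
    by (simp add: orth_compl_def)
next
  assume "x \<in> orth_compl ip M"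
  then have "ip (P x) (P x) = 0"
    using is_orth_proj_in[OF P] is_orth_proj_is_adj[OF P] is_orth_proj_idem[OF P]
    unfolding orth_compl_def is_adj_def by simp
  then show "P x = 0" by (rule ip_definite)
qed

lemma is_orth_proj_diff_in:
  assumes P: "is_orth_proj ip M P"
  shows "x - P x \<in> orth_compl ip M"
  using is_orth_proj_zero_iff[OF P, of "x - P x"] is_orth_proj_idem[OF P, of x]
  by (simp add: linear_diff[OF is_orth_proj_linear[OF P]])

lemma ip_orth_proj_self:
  assumes P: "is_orth_proj ip M P"
  shows "ip (P x) (P x) = ip (P x) x"
  using is_orth_proj_is_adj[OF P] is_orth_proj_idem[OF P] by (simp add: is_adj_def)

text \<open>The cross terms cancel because \<open>ip (P x) (P x)\<close>, \<open>ip (P x) x\<close>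
  and \<open>ip x (P x)\<close> all agree.\<close>

lemma norm_reflection:
  assumes P: "is_orth_proj ip M P"
  shows "norm (2 *\<^sub>R P x - x) = norm x"
proof -
  have "ip x (P x) = ip (P x) x"
    using is_orth_proj_is_adj[OF P] unfolding is_adj_def by metis
  then have "ip (2 *\<^sub>R P x - x) (2 *\<^sub>R P x - x) = ip x x"
    by (simp add: ip_diff_left ip_diff_right ip_scaleR_left ip_scaleR_right
        ip_orth_proj_self[OF P] scaleR_2 ip_add ip_add_left)
  then show ?thesis
    by (simp add: norm_eq)
qed

text \<open>\<open>P\<close> is the average of the identity and an isometric reflection, which
  replaces a comparison in the order of the C*-algebra.\<close>

lemma norm_orth_proj_le:
  assumes P: "is_orth_proj ip M P"
  shows "norm (P x) \<le> norm x"
proof -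
  have "2 * norm (P x) = norm ((2 *\<^sub>R P x - x) + x)" by simp
  also have "\<dots> \<le> norm (2 *\<^sub>R P x - x) + norm x" by (rule norm_triangle_ineq)
  finally show ?thesis by (simp add: norm_reflection[OF P])
qed

section \<open>Decay estimates for alternating products\<close>

context
  fixes M N P Q
  assumes P: "is_orth_proj ip M P" and Q: "is_orth_proj ip N Q"
begin

lemma linear_alternating: "linear ((Q \<circ> P) ^^ n)"
  by (intro linear_funpow linear_compose is_orth_proj_linear[OF P] is_orth_proj_linear[OF Q])

lemma norm_alternating_le: "norm (((Q \<circ> P) ^^ n) x) \<le> norm x"
  by (rule norm_funpow_le)
    (simp add: order_trans[OF norm_orth_proj_le[OF Q] norm_orth_proj_le[OF P]])

lemma is_adj_alternating: "is_adj ip ((Q \<circ> P) ^^ n) ((P \<circ> Q) ^^ n)"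
  by (intro is_adj_funpow is_adj_comp is_orth_proj_is_adj[OF P] is_orth_proj_is_adj[OF Q])

text \<open>On the range of \<open>Q\<close> the map \<open>Q P\<close> is the average of the identity and the
  contraction \<open>Q (2 P - 1)\<close>.\<close>

lemma alternating_asymptotically_regular:
  assumes "y \<in> N"
  shows "norm (((Q \<circ> P) ^^ n) y - ((Q \<circ> P) ^^ Suc n) y) \<le> norm y / sqrt (real (Suc n))"
proof -
  define V where "V = (\<lambda>x. Q (2 *\<^sub>R P x - x))"
  define W where "W = (\<lambda>x. (1/2) *\<^sub>R (x + V x))"
  interpret lQ: linear Q by (rule is_orth_proj_linear[OF Q])
  interpret lP: linear P by (rule is_orth_proj_linear[OF P])
  have "linear V"
    by (rule linearI)
      (simp_all add: V_def lP.add lP.scale lQ.add lQ.diff lQ.scale scaleR_add_right scaleR_diff_right)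
  moreover have "norm (V x) \<le> norm x" for x
    using norm_orth_proj_le[OF Q, of "2 *\<^sub>R P x - x"] by (simp add: V_def norm_reflection[OF P])
  ultimately have reg: "norm ((W ^^ n) y - (W ^^ Suc n) y) \<le> norm y / sqrt (real (Suc n))"
    unfolding W_def by (rule averaged_contraction_asymptotically_regular)
  \<comment> \<open>Here \<open>Q z = z\<close> cancels the term \<open>z\<close> of the average.
    All iterates of \<open>y\<close> stay in \<open>N\<close>, so the powers of both maps agree on
    \<open>y\<close>.\<close>
  have step: "W z = Q (P z)" if "z \<in> N" for z
    using is_orth_proj_fixed_iff[OF Q, of z] that by (simp add: W_def V_def lQ.diff lQ.scale)
  have "((Q \<circ> P) ^^ k) y = (W ^^ k) y \<and> (W ^^ k) y \<in> N" for k
    by (induction k) (simp_all add: assms step is_orth_proj_in[OF Q])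
  then show ?thesis
    using reg by (simp del: funpow.simps)
qed

end

text \<open>The squared defect is at most a constant times the step \<open>z - P (Q z)\<close> times
  \<open>norm z\<close>, and asymptotic regularity with the roles of \<open>P\<close> and
  \<open>Q\<close> exchanged controls the step.\<close>

lemma alternating_defect:
  assumes P: "is_orth_proj ip M P" and Q: "is_orth_proj ip N Q"
  defines "w \<equiv> \<lambda>n y. ((P \<circ> Q) ^^ Suc n) y"
  shows "(norm (w n y - Q (w n y)))\<^sup>2 \<le> 4 * (norm y)\<^sup>2 / sqrt (real (Suc n))"
proof -
  define z where "z = w n y"
  \<comment> \<open>The extra factor makes the iteration start at \<open>P (Q y)\<close>, which lies
    in \<open>M\<close> as asymptotic regularity requires.\<close>
  have z: "z = ((P \<circ> Q) ^^ n) (P (Q y))"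
    by (simp add: z_def w_def funpow_Suc_right del: funpow.simps)
  have Pz: "P z = z"
    by (simp add: z_def w_def is_orth_proj_idem[OF P])
  \<comment> \<open>Since \<open>1 - Q\<close> is a projection, one copy suffices; then
    \<open>P z = z\<close> lets \<open>P\<close> be moved onto \<open>Q z\<close>.\<close>
  have "ip (z - Q z) (z - Q z) = ip (z - Q z) z"
    using is_orth_proj_is_adj[OF Q] ip_orth_proj_self[OF Q, of z] unfolding is_adj_def
    by (metis (no_types, lifting) ip_diff_left ip_diff_right diff_self diff_zero)
  also have "\<dots> = ip (z - P (Q z)) z"
    using is_orth_proj_is_adj[OF P] Pz unfolding is_adj_def by (simp add: ip_diff_left)
  finally have "(norm (z - Q z))\<^sup>2 = norm (ip (z - P (Q z)) z)"
    by (simp add: norm_power2_eq)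
  also have "\<dots> \<le> 4 * norm (z - P (Q z)) * norm z"
    by (rule norm_ip_le)
  also have "\<dots> \<le> 4 * (norm y / sqrt (real (Suc n))) * norm y"
  proof (intro mult_mono)
    have "z - P (Q z) = ((P \<circ> Q) ^^ n) (P (Q y)) - ((P \<circ> Q) ^^ Suc n) (P (Q y))"
      by (simp add: z)
    also have "norm \<dots> \<le> norm (P (Q y)) / sqrt (real (Suc n))"
      by (intro alternating_asymptotically_regular[OF Q P] is_orth_proj_in[OF P])
    also have "\<dots> \<le> norm y / sqrt (real (Suc n))"
      using norm_alternating_le[OF Q P, of 1 y] by (intro divide_right_mono) auto
    finally show "norm (z - P (Q z)) \<le> norm y / sqrt (real (Suc n))" .
    show "norm z \<le> norm y"
      unfolding z_def w_def by (rule norm_alternating_le[OF Q P])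
  qed auto
  finally show ?thesis
    by (simp add: z_def power2_eq_square)
qed

text \<open>Duality: with \<open>u\<close> the iterate of \<open>x\<close>, \<open>ip u u\<close>
  pairs \<open>x\<close> with the adjoint power applied to \<open>u\<close>. As \<open>x\<close> is
  orthogonal to \<open>N\<close>, only the defect of that power counts. Its bound is linear in
  \<open>norm u\<close>, uniformly in \<open>u\<close>, so one factor \<open>norm u\<close>
  cancels.\<close>

lemma alternating_tendsto_zero_complement:
  assumes P: "is_orth_proj ip M P" and Q: "is_orth_proj ip N Q" and x: "x \<in> orth_compl ip N"
  shows "(\<lambda>n. ((Q \<circ> P) ^^ n) x) \<longlonglongrightarrow> 0"
proof -
  \<comment> \<open>The 8 is the 4 of \<open>norm_ip_le\<close> times the 2 obtained as the root of
    the 4 in \<open>alternating_defect\<close>.\<close>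
  have bound: "norm (((Q \<circ> P) ^^ Suc n) x) \<le> 8 * norm x * sqrt (1 / sqrt (real (Suc n)))" for n
  proof -
    define u where "u = ((Q \<circ> P) ^^ Suc n) x"
    define w where "w = ((P \<circ> Q) ^^ Suc n) u"
    have "ip u u = ip x w"
      using is_adj_alternating[OF P Q, of "Suc n"] unfolding is_adj_def u_def w_def by blast
    also have "\<dots> = ip x (w - Q w)"
      using x is_orth_proj_in[OF Q] by (simp add: ip_diff_right orth_compl_def)
    finally have u: "(norm u)\<^sup>2 \<le> 4 * norm x * norm (w - Q w)"
      by (metis norm_power2_eq norm_ip_le)
    have "norm (w - Q w) \<le> 2 * norm u * sqrt (1 / sqrt (real (Suc n)))"
    proof (rule power2_le_imp_le)
      show "(norm (w - Q w))\<^sup>2 \<le> (2 * norm u * sqrt (1 / sqrt (real (Suc n))))\<^sup>2"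
        using alternating_defect[OF P Q, of n u]
        by (simp add: w_def power_mult_distrib del: funpow.simps of_nat_Suc)
    qed simp
    then have "4 * norm x * norm (w - Q w) \<le> 4 * norm x * (2 * norm u * sqrt (1 / sqrt (real (Suc n))))"
      by (rule mult_left_mono) simp
    from order_trans[OF u this]
    have "norm u * norm u \<le> norm u * (8 * norm x * sqrt (1 / sqrt (real (Suc n))))"
      by (simp add: power2_eq_square mult_ac del: of_nat_Suc)
    then show ?thesis
      unfolding u_def[symmetric] by (cases "u = 0") simp_all
  qed
  have "(\<lambda>n. 8 * norm x * sqrt (1 / sqrt (real (Suc n)))) \<longlonglongrightarrow> 8 * norm x * sqrt 0"
    by (intro tendsto_mult tendsto_const tendsto_real_sqrt tendsto_divide_0[OF tendsto_const]
        filterlim_at_top_imp_at_infinity filterlim_compose[OF sqrt_at_top]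
        filterlim_compose[OF filterlim_real_sequentially] filterlim_Suc)
  then have lim: "(\<lambda>n. 8 * norm x * sqrt (1 / sqrt (real (Suc n)))) \<longlonglongrightarrow> 0"
    by (simp only: real_sqrt_zero mult_zero_right)
  have "(\<lambda>n. ((Q \<circ> P) ^^ Suc n) x) \<longlonglongrightarrow> 0"
    by (rule Lim_null_comparison[OF always_eventually[OF allI[OF bound]] lim])
  then show ?thesis
    by (rule LIMSEQ_imp_Suc)
qed

text \<open>All powers are contractions, so convergence to 0 passes from the sum to its
  closure.\<close>

lemma alternating_tendsto_zero_closure:
  assumes P: "is_orth_proj ip M P" and Q: "is_orth_proj ip N Q"
    and v: "v \<in> closure (orth_compl ip M + orth_compl ip N)"
  shows "(\<lambda>n. ((Q \<circ> P) ^^ n) v) \<longlonglongrightarrow> 0"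
proof (rule LIMSEQ_I)
  fix e :: real assume "e > 0"
  with v obtain s where "s \<in> orth_compl ip M + orth_compl ip N" "dist s v < e / 2"
    unfolding closure_approachable by (meson half_gt_zero)
  then obtain a b where a: "a \<in> orth_compl ip M" and b: "b \<in> orth_compl ip N"
    and s: "norm (v - (a + b)) < e / 2"
    by (auto simp: set_plus_def dist_norm norm_minus_commute)
  have "(Q \<circ> P) a = 0"
    using a is_orth_proj_zero_iff[OF P, of a] linear_0[OF is_orth_proj_linear[OF Q]] by simp
  then have a0: "((Q \<circ> P) ^^ Suc n) a = 0" for n
    unfolding funpow_Suc_right by (simp add: linear_0[OF linear_alternating[OF P Q]])
  obtain k where k: "norm (((Q \<circ> P) ^^ n) b) < e / 2" if "n \<ge> k" for n
    using LIMSEQ_D[OF alternating_tendsto_zero_complement[OF P Q b], of "e / 2"] \<open>e > 0\<close> by auto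
  \<comment> \<open>The bound is \<open>Suc k\<close>, as the power 0 is the identity and need not
    annihilate \<open>a\<close>.\<close>
  have "norm (((Q \<circ> P) ^^ n) v - 0) < e" if n: "n \<ge> Suc k" for n
  proof -
    from n have "((Q \<circ> P) ^^ n) a = 0"
      using a0[of "n - 1"] by (cases n) auto
    then have "((Q \<circ> P) ^^ n) v = ((Q \<circ> P) ^^ n) (v - (a + b)) + ((Q \<circ> P) ^^ n) b"
      by (simp add: linear_diff[OF linear_alternating[OF P Q]] linear_add[OF linear_alternating[OF P Q]])
    then have "norm (((Q \<circ> P) ^^ n) v) \<le> norm (v - (a + b)) + norm (((Q \<circ> P) ^^ n) b)"
      using norm_alternating_le[OF P Q, of n "v - (a + b)"] norm_triangle_mono by fastforce
    then show ?thesis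
      using s k[of n] n by simp
  qed
  then show "\<exists>k. \<forall>n\<ge>k. norm (((Q \<circ> P) ^^ n) v - 0) < e" by blast
qed

section \<open>Concordance and convergence\<close>

lemma concordant_imp_convergent_alternating:
  assumes P: "is_orth_proj ip M P" and Q: "is_orth_proj ip N Q" and "concordant ip M N"
  shows "convergent (\<lambda>n. ((Q \<circ> P) ^^ n) x)"
proof -
  from assms(3) have "x \<in> (M \<inter> N) + closure (orth_compl ip M + orth_compl ip N)"
    by (simp add: concordant_def orth_direct_sum_def)
  then obtain u v where u: "u \<in> M \<inter> N" and v: "v \<in> closure (orth_compl ip M + orth_compl ip N)"
    and x: "x = u + v"
    by (auto simp: set_plus_def)
  have "((Q \<circ> P) ^^ n) u = u" for n
    using u is_orth_proj_fixed_iff[OF P, of u] is_orth_proj_fixed_iff[OF Q, of u]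
    by (induction n) auto
  then have "((Q \<circ> P) ^^ n) x = u + ((Q \<circ> P) ^^ n) v" for n
    by (simp add: x linear_add[OF linear_alternating[OF P Q]])
  then show ?thesis
    using tendsto_add[OF tendsto_const[of u] alternating_tendsto_zero_closure[OF P Q v]]
    by (auto simp: convergent_def)
qed

text \<open>A fixed point lies in \<open>N\<close>, and then \<open>ip y y = ip (P y) y\<close>:
  \<open>P\<close> loses no length, so \<open>y - P y\<close> is null.\<close>

lemma alternating_fixed_imp_mem:
  assumes P: "is_orth_proj ip M P" and Q: "is_orth_proj ip N Q" and y: "Q (P y) = y"
  shows "y \<in> M \<inter> N"
proof -
  have "Q y = y"
    using y is_orth_proj_idem[OF Q] by metis
  then have "ip y y = ip (P y) y"
    using y is_orth_proj_is_adj[OF Q] unfolding is_adj_def by metis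
  moreover have "ip y (P y) = ip (P y) y"
    using is_orth_proj_is_adj[OF P] unfolding is_adj_def by metis
  ultimately have "ip (y - P y) (y - P y) = 0"
    by (simp add: ip_diff_left ip_diff_right ip_orth_proj_self[OF P])
  then have "P y = y"
    using ip_definite by force
  with \<open>Q y = y\<close> show ?thesis
    using is_orth_proj_fixed_iff[OF P, of y] is_orth_proj_fixed_iff[OF Q, of y] by simp
qed

lemma orth_compl_add: "x \<in> orth_compl ip M \<Longrightarrow> y \<in> orth_compl ip M \<Longrightarrow> x + y \<in> orth_compl ip M"
  by (simp add: orth_compl_def ip_add_left)

lemma alternating_diff_in:
  assumes P: "is_orth_proj ip M P" and Q: "is_orth_proj ip N Q"
  shows "x - ((Q \<circ> P) ^^ n) x \<in> orth_compl ip M + orth_compl ip N"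
proof (induction n)
  case 0
  have "0 \<in> orth_compl ip M" "0 \<in> orth_compl ip N"
    by (simp_all add: orth_compl_def ip_zero_left)
  then show ?case
    using set_plus_intro by fastforce
next
  case (Suc n)
  let ?y = "((Q \<circ> P) ^^ n) x"
  from Suc obtain a b where ab: "a \<in> orth_compl ip M" "b \<in> orth_compl ip N" "x - ?y = a + b"
    unfolding set_plus_def by blast
  have "x - ((Q \<circ> P) ^^ Suc n) x = (x - ?y) + ((?y - P ?y) + (P ?y - Q (P ?y)))"
    by simp
  also have "\<dots> = (a + (?y - P ?y)) + (b + (P ?y - Q (P ?y)))"
    unfolding ab(3) by (simp only: add_ac)
  also have "\<dots> \<in> orth_compl ip M + orth_compl ip N"
    by (intro set_plus_intro orth_compl_add ab(1,2) is_orth_proj_diff_in[OF P] is_orth_proj_diff_in[OF Q])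
  finally show ?case .
qed

text \<open>Continuity of \<open>ip u\<close> carries orthogonality to the closure. Concordance is
  thus only a question of whether the two summands span.\<close>

lemma orth_closure_orth_compl_sum:
  assumes "u \<in> M \<inter> N" "v \<in> closure (orth_compl ip M + orth_compl ip N)"
  shows "ip u v = 0"
proof -
  have 0: "ip u a = 0" if "a \<in> orth_compl ip M \<or> a \<in> orth_compl ip N" for a
  proof -
    have "ip a u = 0"
      using that assms(1) by (auto simp: orth_compl_def)
    then show ?thesis
      by (metis ip_star ip_zero_left)
  qed
  have "closed {v. ip u v = 0}"
    by (intro closed_Collect_eq continuous_on_const
        linear_continuous_on[OF bounded_linear_ip_right])
  moreover have "orth_compl ip M + orth_compl ip N \<subseteq> {v. ip u v = 0}"
    by (auto simp: set_plus_def ip_add 0)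
  ultimately show ?thesis
    using closure_minimal assms(2) by blast
qed

lemma convergent_alternating_imp_concordant:
  assumes P: "is_orth_proj ip M P" and Q: "is_orth_proj ip N Q"
    and conv: "\<And>x. convergent (\<lambda>n. ((Q \<circ> P) ^^ n) x)"
  shows "concordant ip M N"
  unfolding concordant_def orth_direct_sum_def
proof (intro conjI ballI)
  have "x \<in> (M \<inter> N) + closure (orth_compl ip M + orth_compl ip N)" for x
  proof -
    from conv obtain y where y: "(\<lambda>n. ((Q \<circ> P) ^^ n) x) \<longlonglongrightarrow> y"
      by (auto simp: convergent_def)
    have lin: "linear (Q \<circ> P)"
      using linear_alternating[OF P Q, of 1] by simp
    have "bounded_linear (Q \<circ> P)"
    proof (rule bounded_linear_intro[where K = 1])
      show "norm ((Q \<circ> P) z) \<le> norm z * 1" for z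
        using norm_alternating_le[OF P Q, of 1 z] by simp
    qed (rule linear_add[OF lin] linear_scale[OF lin])+
    \<comment> \<open>By continuity the limit of the iterates is a fixed point of
      \<open>Q \<circ> P\<close>.\<close>
    from bounded_linear.tendsto[OF this y] have "(\<lambda>n. ((Q \<circ> P) ^^ Suc n) x) \<longlonglongrightarrow> Q (P y)"
      by simp
    with LIMSEQ_Suc[OF y] have "Q (P y) = y"
      using LIMSEQ_unique by blast
    then have "y \<in> M \<inter> N"
      by (rule alternating_fixed_imp_mem[OF P Q])
    moreover have "x - y \<in> closure (orth_compl ip M + orth_compl ip N)"
      unfolding closure_sequential
      by (intro exI[of _ "\<lambda>n. x - ((Q \<circ> P) ^^ n) x"] conjI allI
          tendsto_diff[OF tendsto_const[of x] y] alternating_diff_in[OF P Q])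
    ultimately have "y + (x - y) \<in> (M \<inter> N) + closure (orth_compl ip M + orth_compl ip N)"
      by (rule set_plus_intro)
    then show ?thesis by simp
  qed
  then show "(M \<inter> N) + closure (orth_compl ip M + orth_compl ip N) = UNIV"
    by (rule UNIV_eq_I[symmetric])
qed (rule orth_closure_orth_compl_sum)

text \<open>The symmetry yields convergence of the adjoint powers, where \<open>P\<close> and
  \<open>Q\<close> trade places.\<close>

lemma concordant_commute: "concordant ip M N \<longleftrightarrow> concordant ip N M"
  by (simp add: concordant_def Int_commute add.commute)

lemma concordant_iff_star_strong_Cauchy:
  assumes P: "is_orth_proj ip M P" and Q: "is_orth_proj ip N Q"
  shows "concordant ip M N \<longleftrightarrow> star_strong_Cauchy ip (\<lambda>n. (Q \<circ> P) ^^ n)"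
proof
  assume c: "concordant ip M N"
  show "star_strong_Cauchy ip (\<lambda>n. (Q \<circ> P) ^^ n)"
    using concordant_imp_convergent_alternating[OF P Q c]
      concordant_imp_convergent_alternating[OF Q P, unfolded concordant_commute[of N], OF c]
    unfolding star_strong_Cauchy_iff[of "\<lambda>n. (Q \<circ> P) ^^ n", OF is_adj_alternating[OF P Q]]
    by (simp add: Cauchy_convergent_iff)
next
  assume "star_strong_Cauchy ip (\<lambda>n. (Q \<circ> P) ^^ n)"
  then show "concordant ip M N"
    unfolding star_strong_Cauchy_iff[of "\<lambda>n. (Q \<circ> P) ^^ n", OF is_adj_alternating[OF P Q]]
    by (intro convergent_alternating_imp_concordant[OF P Q]) (simp add: Cauchy_convergent_iff)
qed

end

theorem theorem2p9:
  fixes act :: "'x::complex_banach \<Rightarrow> 'b::cstar_algebra \<Rightarrow> 'x"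
    and ip :: "'x \<Rightarrow> 'x \<Rightarrow> 'b"
    and M N :: "'x set"
    and P\<^sub>M P\<^sub>N :: "'x \<Rightarrow> 'x"
  assumes "hilbert_module act ip"
    and "complemented act ip M"
    and "complemented act ip N"
    and "is_orth_proj ip M P\<^sub>M"
    and "is_orth_proj ip N P\<^sub>N"
  shows "concordant ip M N \<longleftrightarrow> star_strong_Cauchy ip (\<lambda>n. (P\<^sub>N \<circ> P\<^sub>M) ^^ n)"
  using hilbert_module.concordant_iff_star_strong_Cauchy[OF assms(1,4,5)] .

end
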